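(* Let $\mathcal H_i,\mathcal H_o$ be finite-dimensional complex Hilbert spaces with fixed computational (orthonormal) bases, let $\widetilde P_i:\mathcal L(\mathcal H_i)\to\mathcal L(\mathcal H_i)$ and $\widetilde P_o:\mathcal L(\mathcal H_o)\to\mathcal L(\mathcal H_o)$ be linear maps with $\widetilde P_i^2=\widetilde P_i$ and $\widetilde P_o^2=\widetilde P_o$, and define the linear spaces $$\mathcal S_i=\{W\in\mathcal L(\mathcal H_i):\widetilde P_i[W]=W\},\qquad \mathcal S_o=\{W'\in\mathcal L(\mathcal H_o):\widetilde P_o[W']=W'\}.$$ Then a linear map $\widetilde T_{io}:\mathcal L(\mathcal H_i)\to\mathcal L(\mathcal H_o)$ satisfies $\widetilde T_{io}[W]\in\mathcal S_o$ for all $W\in\mathcal S_i$ if and only if its Choi matrix $T_{io}$ satisfies $$T_{io}=T_{io}-(\widetilde P_i^{\tau}\otimes\widetilde{\mathbb 1}_o)[T_{io}]+(\widetilde P_i^{\tau}\otimes\widetilde P_o)[T_{io}].$$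
   Context: $\mathcal L(\mathcal H)$ is the space of linear operators on $\mathcal H$. The Choi matrix of $\widetilde T:\mathcal L(\mathcal H_i)\to\mathcal L(\mathcal H_o)$ is $T=\sum_{jk}|j\rangle\langle k|\otimes\widetilde T[|j\rangle\langle k|]\in\mathcal L(\mathcal H_i\otimes\mathcal H_o)$, with $\{|j\rangle\}$ the computational basis of $\mathcal H_i$. The adjoint $\widetilde P^\dagger$ of a linear map is defined by $\operatorname{tr}[B^\dagger\widetilde P[A]]=\operatorname{tr}[\widetilde P^\dagger[B]^\dagger A]$ for all $A,B$. For a linear map $\widetilde P_i$ on $\mathcal L(\mathcal H_i)$, $\widetilde P_i^\tau$ is the linear map $\widetilde P_i^\tau[A]:=\big(\widetilde P_i^\dagger[A^*]\big)^*$, where $*$ is entrywise complex conjugation in the computational basis. $\widetilde{\mathbb 1}_o$ is the identity map on $\mathcal L(\mathcal H_o)$. *)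

theory Defs
  imports "HOL-Analysis.Analysis"
begin

text \<open>
  A finite-dimensional complex Hilbert space with a fixed computational basis indexed by a finite
  type \<open>'n\<close> is \<open>complex^'n\<close>, and its space of linear operators is \<open>complex^'n^'n\<close>
  (\<open>A $ j $ k\<close> being the entry in row \<open>j\<close> and column \<open>k\<close>).  The tensor product of the spaces
  with basis types \<open>'m\<close> and \<open>'n\<close> has basis type \<open>'m \<times> 'n\<close>.
\<close>

text \<open>
  The library scalar multiplication \<open>(*\<^sub>R)\<close> on \<open>complex^'n^'n\<close> is by reals only.
\<close>

definition cscale :: "complex \<Rightarrow> complex^'m^'n \<Rightarrow> complex^'m^'n" where
  "cscale c A = map_matrix (\<lambda>x. c * x) A"

abbreviation clinear_map :: "(complex^'m^'m \<Rightarrow> complex^'n^'n) \<Rightarrow> bool" where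
  "clinear_map P \<equiv> Vector_Spaces.linear cscale cscale P"

definition dagger :: "complex^'m^'n \<Rightarrow> complex^'n^'m" where
  "dagger A = transpose (map_matrix cnj A)"

text \<open>\<open>matrix_unit j k\<close> is \<open>|j\<rangle>\<langle>k|\<close>.\<close>

definition matrix_unit :: "'n::finite \<Rightarrow> 'n \<Rightarrow> complex^'n^'n" where
  "matrix_unit j k = axis j (axis k 1)"

definition tensor_mat ::
    "complex^'m^'m \<Rightarrow> complex^'n^'n \<Rightarrow> complex^('m \<times> 'n)^('m \<times> 'n)" where
  "tensor_mat A B = (\<chi> p q. A $ fst p $ fst q * B $ snd p $ snd q)"

text \<open>
  The linear extension of \<open>|j\<rangle>\<langle>k| \<otimes> |l\<rangle>\<langle>r| \<mapsto> P[|j\<rangle>\<langle>k|] \<otimes> Q[|l\<rangle>\<langle>r|]\<close>.  For linear \<open>P\<close> and \<open>Q\<close> it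
  is the tensor product of the two maps, see \<open>tensor_map_tensor_mat\<close> and
  \<open>tensor_map_unique\<close> below.
\<close>

definition tensor_map ::
    "(complex^'m^'m \<Rightarrow> complex^'m^'m) \<Rightarrow> (complex^'n^'n \<Rightarrow> complex^'n^'n) \<Rightarrow>
     complex^('m \<times> 'n)^('m \<times> 'n) \<Rightarrow> complex^('m \<times> 'n)^('m \<times> 'n)" where
  "tensor_map P Q M =
     (\<Sum>j\<in>UNIV. \<Sum>k\<in>UNIV. \<Sum>l\<in>UNIV. \<Sum>r\<in>UNIV.
        cscale (M $ (j, l) $ (k, r))
          (tensor_mat (P (matrix_unit j k)) (Q (matrix_unit l r))))"

definition choi ::
    "(complex^'m^'m \<Rightarrow> complex^'n^'n) \<Rightarrow> complex^('m \<times> 'n)^('m \<times> 'n)" where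
  "choi T = (\<Sum>j\<in>UNIV. \<Sum>k\<in>UNIV. tensor_mat (matrix_unit j k) (T (matrix_unit j k)))"

text \<open>
  The adjoint for the Hilbert-Schmidt inner product; for linear \<open>P\<close> it exists and is unique, see
  \<open>hs_adjoint_eqI\<close> and \<open>hs_adjoint_trace\<close> below.
\<close>

definition hs_adjoint ::
    "(complex^'m^'m \<Rightarrow> complex^'n^'n) \<Rightarrow> complex^'n^'n \<Rightarrow> complex^'m^'m" where
  "hs_adjoint P =
     (THE P'. \<forall>A B. trace (dagger B ** P A) = trace (dagger (P' B) ** A))"

definition tau_map :: "(complex^'n^'n \<Rightarrow> complex^'n^'n) \<Rightarrow> complex^'n^'n \<Rightarrow> complex^'n^'n" where
  "tau_map P A = map_matrix cnj (hs_adjoint P (map_matrix cnj A))"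


lemma vector_space_cscale: "vector_space (cscale :: complex \<Rightarrow> complex^'m^'n \<Rightarrow> _)"
  by unfold_locales (auto simp: cscale_def map_matrix_def vec_eq_iff algebra_simps)

lemma clinear_map_iff:
  fixes P :: "complex^'m^'m \<Rightarrow> complex^'n^'n"
  shows "clinear_map P \<longleftrightarrow>
    (\<forall>A B. P (A + B) = P A + P B) \<and> (\<forall>c A. P (cscale c A) = cscale c (P A))"
  by (auto simp: Vector_Spaces.linear_def module_hom_def module_hom_axioms_def
      module_iff_vector_space vector_space_cscale)

lemma cscale_nth [simp]: "cscale c A $ j $ k = c * A $ j $ k"
  by (simp add: cscale_def map_matrix_def)

lemma matrix_unit_nth: "matrix_unit j k $ a $ b = (if a = j \<and> b = k then 1 else 0)"
  by (auto simp: matrix_unit_def axis_def)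

lemma tensor_mat_nth: "tensor_mat A B $ p $ q = A $ fst p $ fst q * B $ snd p $ snd q"
  by (simp add: tensor_mat_def)

lemma matrix_unit_expansion:
  "A = (\<Sum>j\<in>UNIV. \<Sum>k\<in>UNIV. cscale (A $ j $ k) (matrix_unit j k))"
proof -
  have "(\<Sum>j\<in>UNIV. \<Sum>k\<in>UNIV. A $ j $ k * (if a = j \<and> b = k then 1 else 0)) = A $ a $ b" for a b
  proof -
    have "(\<Sum>j\<in>UNIV. \<Sum>k\<in>UNIV. A $ j $ k * (if a = j \<and> b = k then 1 else 0)) =
        (\<Sum>j\<in>UNIV. if a = j then \<Sum>k\<in>UNIV. if b = k then A $ j $ k else 0 else 0)"
      by (intro sum.cong refl) (auto simp: if_distrib cong: if_cong)
    then show ?thesis by simp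
  qed
  then show ?thesis by (simp add: vec_eq_iff matrix_unit_nth)
qed

lemma clinear_map_expansion:
  assumes "clinear_map P"
  shows "P A = (\<Sum>j\<in>UNIV. \<Sum>k\<in>UNIV. cscale (A $ j $ k) (P (matrix_unit j k)))"
proof -
  interpret P: Vector_Spaces.linear cscale cscale P by fact
  show ?thesis
    by (subst matrix_unit_expansion[of A]) (simp add: P.sum P.scale)
qed

lemma trace_dagger_mult: "trace (dagger B ** A) = (\<Sum>j\<in>UNIV. \<Sum>k\<in>UNIV. cnj (B $ j $ k) * A $ j $ k)"
  unfolding trace_def dagger_def transpose_def map_matrix_def matrix_matrix_mult_def
  by (simp, rule sum.swap)

lemma trace_dagger_matrix_unit: "trace (dagger B ** matrix_unit j k) = cnj (B $ j $ k)"
proof -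
  have "(\<Sum>a\<in>UNIV. \<Sum>b\<in>UNIV. cnj (B $ a $ b) * (if a = j \<and> b = k then 1 else 0)) =
      (\<Sum>a\<in>UNIV. if a = j then \<Sum>b\<in>UNIV. if b = k then cnj (B $ a $ b) else 0 else 0)"
    by (intro sum.cong refl) (auto simp: if_distrib cong: if_cong)
  then show ?thesis by (simp add: trace_dagger_mult matrix_unit_nth)
qed

lemma hs_adjoint_eqI:
  assumes "\<And>A B. trace (dagger B ** P A) = trace (dagger (P' B) ** A)"
  shows "hs_adjoint P = P'"
  unfolding hs_adjoint_def
proof (rule the_equality)
  fix P'' assume *: "\<forall>A B. trace (dagger B ** P A) = trace (dagger (P'' B) ** A)"
  show "P'' = P'"
  proof
    fix B
    have "cnj (P'' B $ j $ k) = cnj (P' B $ j $ k)" for j k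
      using * assms by (metis trace_dagger_matrix_unit)
    then show "P'' B = P' B" by (simp add: vec_eq_iff)
  qed
qed (use assms in blast)

lemma sum_swap4:
  "(\<Sum>a\<in>A. \<Sum>b\<in>B. \<Sum>j\<in>C. \<Sum>k\<in>D. f a b j k) =
   (\<Sum>j\<in>C. \<Sum>k\<in>D. \<Sum>a\<in>A. \<Sum>b\<in>B. (f a b j k :: complex))"
proof -
  have "(\<Sum>a\<in>A. \<Sum>b\<in>B. \<Sum>j\<in>C. \<Sum>k\<in>D. f a b j k) =
        (\<Sum>a\<in>A. \<Sum>j\<in>C. \<Sum>k\<in>D. \<Sum>b\<in>B. f a b j k)"
    by (intro sum.cong refl, subst sum.swap, intro sum.cong refl, rule sum.swap)
  also have "\<dots> = (\<Sum>j\<in>C. \<Sum>k\<in>D. \<Sum>a\<in>A. \<Sum>b\<in>B. f a b j k)"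
    by (subst sum.swap, intro sum.cong refl, rule sum.swap)
  finally show ?thesis .
qed

lemma hs_adjoint_trace:
  assumes "clinear_map P"
  shows "trace (dagger B ** P A) = trace (dagger (hs_adjoint P B) ** A)"
proof -
  define P' where "P' B = (\<chi> j k. cnj (trace (dagger B ** P (matrix_unit j k))))" for B
  have P': "trace (dagger B ** P A) = trace (dagger (P' B) ** A)" for A B
  proof -
    have "trace (dagger B ** P A) =
      (\<Sum>a\<in>UNIV. \<Sum>b\<in>UNIV. cnj (B $ a $ b) *
         (\<Sum>j\<in>UNIV. \<Sum>k\<in>UNIV. A $ j $ k * P (matrix_unit j k) $ a $ b))"
      by (subst clinear_map_expansion[OF assms]) (simp add: trace_dagger_mult)
    also have "\<dots> = (\<Sum>j\<in>UNIV. \<Sum>k\<in>UNIV. \<Sum>a\<in>UNIV. \<Sum>b\<in>UNIV.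
         cnj (B $ a $ b) * (A $ j $ k * P (matrix_unit j k) $ a $ b))"
      unfolding sum_distrib_left by (rule sum_swap4)
    also have "\<dots> = trace (dagger (P' B) ** A)"
      by (simp add: P'_def trace_dagger_mult sum_distrib_left sum_distrib_right mult_ac)
    finally show ?thesis .
  qed
  then have "hs_adjoint P = P'" by (rule hs_adjoint_eqI)
  with P' show ?thesis by simp
qed

lemma clinear_map_tensor_map: "clinear_map (tensor_map P Q)"
  unfolding clinear_map_iff tensor_map_def
  by (simp add: vec_eq_iff sum.distrib sum_distrib_left algebra_simps)

lemma tensor_map_tensor_mat:
  assumes "clinear_map P" "clinear_map Q"
  shows "tensor_map P Q (tensor_mat A B) = tensor_mat (P A) (Q B)"
proof -
  have PA: "P A $ a $ b = (\<Sum>j\<in>UNIV. \<Sum>k\<in>UNIV. A $ j $ k * P (matrix_unit j k) $ a $ b)" for a b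
    by (subst clinear_map_expansion[OF assms(1)]) simp
  have QB: "Q B $ a $ b = (\<Sum>l\<in>UNIV. \<Sum>r\<in>UNIV. B $ l $ r * Q (matrix_unit l r) $ a $ b)" for a b
    by (subst clinear_map_expansion[OF assms(2)]) simp
  have "tensor_mat (P A) (Q B) $ p $ q = tensor_map P Q (tensor_mat A B) $ p $ q" for p q
    unfolding tensor_map_def tensor_mat_nth PA QB sum_distrib_right
    unfolding sum_distrib_left
    by (simp add: tensor_mat_nth mult_ac)
  then show ?thesis by (simp add: vec_eq_iff)
qed

lemma tensor_map_unique:
  assumes "clinear_map P" "clinear_map Q" "clinear_map R"
    and "\<And>A B. R (tensor_mat A B) = tensor_mat (P A) (Q B)"
  shows "R = tensor_map P Q"
proof
  fix M
  have unit: "matrix_unit p q =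
      tensor_mat (matrix_unit (fst p) (fst q)) (matrix_unit (snd p) (snd q))"
    for p q :: "'a \<times> 'b"
    by (auto simp: vec_eq_iff tensor_mat_nth matrix_unit_nth prod_eq_iff)
  show "R M = tensor_map P Q M"
    by (subst (1 2) clinear_map_expansion)
       (simp_all add: assms clinear_map_tensor_map unit tensor_map_tensor_mat)
qed

end

theory Submission
  imports Defs
begin

text \<open>
  Contraction with the Choi matrix gives
  \<open>(P\<^sup>\<tau> \<otimes> Q)[choi T] = choi (Q \<circ> T \<circ> P)\<close>.  Since the Choi matrix determines a linear map, the
  stated identity says \<open>T \<circ> P_i = P_o \<circ> T \<circ> P_i\<close>, which is the preservation condition because
  \<open>S_i\<close> is the range of the projection \<open>P_i\<close>.
\<close>

lemma choi_nth: "choi T $ (j, l) $ (k, r) = T (matrix_unit j k) $ l $ r"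
proof -
  have "choi T $ (j, l) $ (k, r) =
      (\<Sum>a\<in>UNIV. if j = a then \<Sum>b\<in>UNIV. if k = b then T (matrix_unit a b) $ l $ r else 0 else 0)"
    unfolding choi_def sum_component tensor_mat_nth
    by (intro sum.cong refl) (auto simp: matrix_unit_nth if_distrib if_distribR cong: if_cong intro!: sum.cong)
  then show ?thesis by simp
qed

text \<open>The blocks of a Choi matrix are the images of the matrix units. These span the operator
  space, so linearity recovers the map.\<close>

lemma choi_eq_iff:
  assumes "clinear_map S" and "clinear_map T"
  shows "choi S = choi T \<longleftrightarrow> S = T"
proof
  assume "choi S = choi T"
  then have "S (matrix_unit j k) = T (matrix_unit j k)" for j k
    by (metis (no_types, lifting) vec_eq_iff choi_nth)
  then have "S A = T A" for A
    using clinear_map_expansion[OF assms(1), of A] clinear_map_expansion[OF assms(2), of A] by simp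
  then show "S = T" ..
qed simp

lemma clinear_map_comp: "clinear_map S \<Longrightarrow> clinear_map T \<Longrightarrow> clinear_map (S \<circ> T)"
  by (simp add: clinear_map_iff)

text \<open>The conjugations in \<open>tau_map\<close> cancel those of the Hilbert-Schmidt inner
  product: \<open>tau_map P\<close> is the transpose of \<open>P\<close> for the bilinear pairing
  that sums products of entries.\<close>

lemma tau_map_matrix_unit_nth:
  assumes "clinear_map P"
  shows "tau_map P (matrix_unit j k) $ a $ b = P (matrix_unit a b) $ j $ k"
proof -
  have real_unit: "map_matrix cnj (matrix_unit j k) = matrix_unit j k"
    by (simp add: vec_eq_iff map_matrix_def matrix_unit_nth)
  have "tau_map P (matrix_unit j k) $ a $ b =
      trace (dagger (hs_adjoint P (matrix_unit j k)) ** matrix_unit a b)"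
    unfolding tau_map_def real_unit trace_dagger_matrix_unit by (simp add: map_matrix_def)
  also have "\<dots> = trace (dagger (matrix_unit j k) ** P (matrix_unit a b))"
    by (simp add: hs_adjoint_trace[OF assms])
  \<comment> \<open>Conjugate symmetry of the inner product puts the matrix unit on the right, where
    the trace picks out a single entry.\<close>
  also have "\<dots> = cnj (trace (dagger (P (matrix_unit a b)) ** matrix_unit j k))"
    by (simp add: trace_dagger_mult mult.commute)
  also have "\<dots> = P (matrix_unit a b) $ j $ k"
    by (simp add: trace_dagger_matrix_unit)
  finally show ?thesis .
qed

text \<open>On the input factor, transposing \<open>P\<close> moves it into the argument of
  \<open>T\<close>: the sum of P^tau[E_jk] \<otimes> T[E_jk] equals the sum of E_ab \<otimes>
  T[P[E_ab]]. On the output factor, \<open>Q\<close> simply acts after \<open>T\<close>.\<close>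

lemma tensor_map_tau_map_choi:
  assumes "clinear_map P" and "clinear_map Q" and "clinear_map T"
  shows "tensor_map (tau_map P) Q (choi T) = choi (Q \<circ> T \<circ> P)"
proof -
  have "tensor_map (tau_map P) Q (choi T) $ (a, c) $ (b, d) = choi (Q \<circ> T \<circ> P) $ (a, c) $ (b, d)"
    for a b c d
  proof -
    have "choi (Q \<circ> T \<circ> P) $ (a, c) $ (b, d) =
        (\<Sum>j\<in>UNIV. \<Sum>k\<in>UNIV. P (matrix_unit a b) $ j $ k * Q (T (matrix_unit j k)) $ c $ d)"
      using clinear_map_expansion[OF clinear_map_comp[OF assms(2,3)], of "P (matrix_unit a b)"]
      by (simp add: choi_nth)
    \<comment> \<open>Expanding \<open>Q\<close> as well exposes the entries of
      \<open>choi T\<close> as coefficients and yields the fourfold sum of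
      \<open>tensor_map\<close>.\<close>
    also have "\<dots> = (\<Sum>j\<in>UNIV. \<Sum>k\<in>UNIV. P (matrix_unit a b) $ j $ k *
        (\<Sum>l\<in>UNIV. \<Sum>r\<in>UNIV. T (matrix_unit j k) $ l $ r * Q (matrix_unit l r) $ c $ d))"
      by (intro sum.cong refl, subst clinear_map_expansion[OF assms(2)]) simp
    also have "\<dots> = tensor_map (tau_map P) Q (choi T) $ (a, c) $ (b, d)"
      by (simp add: tensor_map_def choi_nth tensor_mat_nth tau_map_matrix_unit_nth[OF assms(1)]
          sum_distrib_left mult_ac)
    finally show ?thesis ..
  qed
  then show ?thesis by (simp add: vec_eq_iff)
qed

theorem theorem6:
  fixes P_i :: "complex^'i^'i \<Rightarrow> complex^'i^'i"
    and P_o :: "complex^'o^'o \<Rightarrow> complex^'o^'o"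
    and T_io :: "complex^'i^'i \<Rightarrow> complex^'o^'o"
    and S_i :: "(complex^'i^'i) set"
    and S_o :: "(complex^'o^'o) set"
  assumes "clinear_map P_i" and "clinear_map P_o"
    and "P_i \<circ> P_i = P_i" and "P_o \<circ> P_o = P_o"
    and "S_i = {W. P_i W = W}" and "S_o = {W'. P_o W' = W'}"
    and "clinear_map T_io"
  shows "(\<forall>W\<in>S_i. T_io W \<in> S_o) \<longleftrightarrow>
    choi T_io = choi T_io - tensor_map (tau_map P_i) id (choi T_io)
                + tensor_map (tau_map P_i) P_o (choi T_io)"
proof -
  have lin_id: "clinear_map (id :: complex^'o^'o \<Rightarrow> complex^'o^'o)"
    by (simp add: clinear_map_iff)
  have idem: "P_i (P_i W) = P_i W" for W
    using assms(3) by (metis comp_apply)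
  have "(\<forall>W\<in>S_i. T_io W \<in> S_o) \<longleftrightarrow> (\<forall>W. P_o (T_io (P_i W)) = T_io (P_i W))"
  proof
    assume "\<forall>W\<in>S_i. T_io W \<in> S_o"
    \<comment> \<open>Idempotence puts every \<open>P_i W\<close> into \<open>S_i\<close>.\<close>
    then show "\<forall>W. P_o (T_io (P_i W)) = T_io (P_i W)"
      by (simp add: assms(5,6) idem)
  next
    assume *: "\<forall>W. P_o (T_io (P_i W)) = T_io (P_i W)"
    have "P_o (T_io W) = T_io W" if "P_i W = W" for W
      using spec[OF *, of W] that by simp
    then show "\<forall>W\<in>S_i. T_io W \<in> S_o"
      by (simp add: assms(5,6))
  qed
  \<comment> \<open>The identity is inserted so that both sides have the shape
    \<open>Q \<circ> T \<circ> P\<close> of the contraction formula.\<close>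
  also have "\<dots> \<longleftrightarrow> id \<circ> T_io \<circ> P_i = P_o \<circ> T_io \<circ> P_i"
    by (auto simp: fun_eq_iff)
  also have "\<dots> \<longleftrightarrow> choi (id \<circ> T_io \<circ> P_i) = choi (P_o \<circ> T_io \<circ> P_i)"
    by (intro choi_eq_iff[symmetric] clinear_map_comp lin_id assms)
  also have "\<dots> \<longleftrightarrow> tensor_map (tau_map P_i) id (choi T_io) =
      tensor_map (tau_map P_i) P_o (choi T_io)"
    by (simp only: tensor_map_tau_map_choi assms(1,2,7) lin_id)
  also have "\<dots> \<longleftrightarrow> choi T_io = choi T_io - tensor_map (tau_map P_i) id (choi T_io)
      + tensor_map (tau_map P_i) P_o (choi T_io)"
    by (auto simp: algebra_simps)
  finally show ?thesis .
qed

end
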